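(* For $n\in\{1,2\}$, $\mathcal{T}(n)\cong K_{T(n)}$. For $n=3$, $\sigma(\mathcal{T}(3))=\{4,0^{[3]},-2^{[2]}\}$. Furthermore, for every integer $n\ge4$: (1) if $n$ is odd, then $$\sigma(\mathcal{T}(n))=\left\{2n-2,\ (n-3)^{[3]},\dots,\left(\tfrac{n-3}{2}\right)^{[3]},\ \left(\tfrac{n-7}{2}\right)^{[2]},\ \left(\tfrac{n-9}{2}\right)^{[3]},\dots,(-2)^{[3]},\ (-3)^{[T(n-3)]}\right\};$$ (2) if $n$ is even, then $$\sigma(\mathcal{T}(n))=\left\{2n-2,\ (n-3)^{[3]},\dots,\left(\tfrac{n-2}{2}\right)^{[3]},\ \left(\tfrac{n-4}{2}\right)^{[2]},\ \left(\tfrac{n-8}{2}\right)^{[3]},\dots,(-2)^{[3]},\ (-3)^{[T(n-3)]}\right\}.$$ Here each run "$a^{[3]},\dots,b^{[3]}$" ranges over all integers from $a$ down to $b$, each with multiplicity $3$.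
   Context: $T(m)=\frac{m(m+1)}{2}$. For a positive integer $n$, the triangular graph $\mathcal{T}(n)$ is the simple graph with vertex set $V=\{(i,j)\mid i\in\{1,\dots,n\},\ j\in\{1,\dots,i\}\}$ (so $|V|=T(n)$), in which two distinct vertices $(i,j)$ and $(k,\ell)$ are adjacent if and only if $i=k$ or $j=\ell$ or $i-j=k-\ell$. $K_m$ is the complete graph on $m$ vertices. $\sigma(G)$ denotes the spectrum (multiset of eigenvalues) of the adjacency matrix of $G$; $\mu^{[k]}$ means that $\mu$ is an eigenvalue with multiplicity exactly $k$, and an eigenvalue written without exponent has multiplicity $1$. *)

theory Defs
  imports
    "Graph_Theory.Graph_Theory"
    "Jordan_Normal_Form.Char_Poly"
    "HOL-Library.Multiset"
begin

text \<open>
  A finite simple graph is a \<open>pair_graph\<close> of the library: an irreflexive symmetric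
  set of pairs over a finite vertex set.
\<close>

definition triangular_number :: "nat \<Rightarrow> nat" where
  "triangular_number m = m * (m + 1) div 2"

text \<open>The difference of the coordinates is taken in the integers, not truncated.\<close>

definition triangular_graph :: "nat \<Rightarrow> (nat \<times> nat) pair_pre_digraph" where
  "triangular_graph n =
    (let V = (SIGMA i : {1..n}. {1..i}) in
     \<lparr> pverts = V,
       parcs = {((i, j), (k, l)) | i j k l.
         (i, j) \<in> V \<and> (k, l) \<in> V \<and> (i, j) \<noteq> (k, l) \<and>
         (i = k \<or> j = l \<or> int i - int j = int k - int l)} \<rparr>)"

definition complete_graph :: "nat \<Rightarrow> nat pair_pre_digraph" where
  "complete_graph m =
    \<lparr> pverts = {..<m}, parcs = {(u, v). u < m \<and> v < m \<and> u \<noteq> v} \<rparr>"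

definition graph_isomorphic :: "'a pair_pre_digraph \<Rightarrow> 'b pair_pre_digraph \<Rightarrow> bool" where
  "graph_isomorphic G H \<longleftrightarrow> digraph_iso (with_proj G) (with_proj H)"

text \<open>
  The adjacency matrix with respect to an enumeration \<open>vs\<close> of the vertices.
\<close>

definition adjacency_matrix :: "'a pair_pre_digraph \<Rightarrow> 'a list \<Rightarrow> real mat" where
  "adjacency_matrix G vs =
    mat (length vs) (length vs) (\<lambda>(i, j). if (vs ! i, vs ! j) \<in> parcs G then 1 else 0)"

text \<open>
  Eigenvalues are counted with their multiplicity as roots of the characteristic
  polynomial. The matrix of a simple graph is real symmetric, so real roots suffice.
  The enumeration is arbitrary; \<open>graph_spectrum_eq\<close> below shows that it does not matter.
\<close>

definition graph_spectrum :: "'a pair_pre_digraph \<Rightarrow> real multiset" where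
  "graph_spectrum G =
    proots (char_poly (adjacency_matrix G (SOME vs. distinct vs \<and> set vs = pverts G)))"

lemma char_poly_adjacency_matrix_unique:
  assumes "distinct vs" "distinct ws" "set vs = set ws"
  shows "char_poly (adjacency_matrix G vs) = char_poly (adjacency_matrix G ws)"
proof -
  define n where "n = length vs"
  have lvs: "length vs = n" by (simp add: n_def)
  have lws: "length ws = n"
    using assms by (metis distinct_card n_def)
  have perm: "\<exists>p. \<forall>i<n. p i < n \<and> ys ! p i = xs ! i"
    if "set xs = set ys" "length xs = n" "length ys = n" for xs ys :: "'a list"
  proof -
    have "\<forall>i. \<exists>j. i < n \<longrightarrow> j < n \<and> ys ! j = xs ! i"
      using that by (metis in_set_conv_nth)
    then show ?thesis by metis
  qed
  obtain p where p: "\<And>i. i < n \<Longrightarrow> p i < n" "\<And>i. i < n \<Longrightarrow> ws ! p i = vs ! i"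
    using perm[of vs ws] assms(3) lvs lws by blast
  obtain q where q: "\<And>i. i < n \<Longrightarrow> q i < n" "\<And>i. i < n \<Longrightarrow> vs ! q i = ws ! i"
    using perm[of ws vs] assms(3) lvs lws by metis
  define A where "A = adjacency_matrix G vs"
  define B where "B = adjacency_matrix G ws"
  define P where "P = mat n n (\<lambda>(i, j). if vs ! i = ws ! j then 1 else 0 :: real)"
  define Q where "Q = mat n n (\<lambda>(i, j). if ws ! i = vs ! j then 1 else 0 :: real)"
  have carr: "A \<in> carrier_mat n n" "B \<in> carrier_mat n n" "P \<in> carrier_mat n n" "Q \<in> carrier_mat n n"
    by (auto simp: A_def B_def P_def Q_def adjacency_matrix_def lvs lws)
  have piff: "vs ! i = ws ! j \<longleftrightarrow> j = p i" if "i < n" "j < n" for i j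
    using that p assms(2) lws by (metis nth_eq_iff_index_eq)
  have qiff: "ws ! i = vs ! j \<longleftrightarrow> j = q i" if "i < n" "j < n" for i j
    using that q assms(1) lvs by (metis nth_eq_iff_index_eq)
  have PM: "(P * M) $$ (i, j) = M $$ (p i, j)" if "M \<in> carrier_mat n n" "i < n" "j < n" for M i j
  proof -
    have "(P * M) $$ (i, j) = (\<Sum>k<n. P $$ (i, k) * M $$ (k, j))"
      using that carr by (auto simp: scalar_prod_def atLeast0LessThan)
    also have "\<dots> = (\<Sum>k<n. if k = p i then M $$ (k, j) else 0)"
      using that by (intro sum.cong) (auto simp: P_def piff)
    also have "\<dots> = M $$ (p i, j)" using p that by simp
    finally show ?thesis .
  qed
  have QM: "(Q * M) $$ (i, j) = M $$ (q i, j)" if "M \<in> carrier_mat n n" "i < n" "j < n" for M i j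
  proof -
    have "(Q * M) $$ (i, j) = (\<Sum>k<n. Q $$ (i, k) * M $$ (k, j))"
      using that carr by (auto simp: scalar_prod_def atLeast0LessThan)
    also have "\<dots> = (\<Sum>k<n. if k = q i then M $$ (k, j) else 0)"
      using that by (intro sum.cong) (auto simp: Q_def qiff)
    also have "\<dots> = M $$ (q i, j)" using q that by simp
    finally show ?thesis .
  qed
  have MQ: "(M * Q) $$ (i, j) = M $$ (i, p j)" if "M \<in> carrier_mat n n" "i < n" "j < n" for M i j
  proof -
    have "(M * Q) $$ (i, j) = (\<Sum>k<n. M $$ (i, k) * Q $$ (k, j))"
      using that carr by (auto simp: scalar_prod_def atLeast0LessThan)
    also have "\<dots> = (\<Sum>k<n. if k = p j then M $$ (i, k) else 0)"
      using that by (intro sum.cong) (auto simp: Q_def eq_commute[of "ws ! _"] piff)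
    also have "\<dots> = M $$ (i, p j)" using p that by simp
    finally show ?thesis .
  qed
  have PQ: "P * Q = 1\<^sub>m n"
  proof (rule eq_matI)
    fix i j assume ij: "i < dim_row (1\<^sub>m n :: real mat)" "j < dim_col (1\<^sub>m n :: real mat)"
    then have "(P * Q) $$ (i, j) = Q $$ (p i, j)" using PM carr by simp
    also have "\<dots> = 1\<^sub>m n $$ (i, j)"
      using ij p assms(1) lvs by (auto simp: Q_def nth_eq_iff_index_eq)
    finally show "(P * Q) $$ (i, j) = 1\<^sub>m n $$ (i, j)" .
  qed (use carr in auto)
  have QP: "Q * P = 1\<^sub>m n"
  proof (rule eq_matI)
    fix i j assume ij: "i < dim_row (1\<^sub>m n :: real mat)" "j < dim_col (1\<^sub>m n :: real mat)"
    then have "(Q * P) $$ (i, j) = P $$ (q i, j)" using QM carr by simp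
    also have "\<dots> = 1\<^sub>m n $$ (i, j)"
      using ij q assms(2) lws by (auto simp: P_def nth_eq_iff_index_eq)
    finally show "(Q * P) $$ (i, j) = 1\<^sub>m n $$ (i, j)" .
  qed (use carr in auto)
  have "A = P * B * Q"
  proof (rule eq_matI)
    fix i j assume "i < dim_row (P * B * Q)" "j < dim_col (P * B * Q)"
    then have ij: "i < n" "j < n" using carr by auto
    have "(P * B * Q) $$ (i, j) = (P * B) $$ (i, p j)" using carr ij by (intro MQ) auto
    also have "\<dots> = B $$ (p i, p j)" using carr ij p by (intro PM) auto
    also have "\<dots> = A $$ (i, j)"
      using ij p by (simp add: A_def B_def adjacency_matrix_def lvs lws)
    finally show "A $$ (i, j) = (P * B * Q) $$ (i, j)" by simp
  qed (use carr in auto)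
  then have "similar_mat A B"
    unfolding similar_mat_def using similar_mat_witI[OF PQ QP _ carr] by blast
  then show ?thesis
    unfolding A_def B_def by (rule char_poly_similar)
qed

lemma graph_spectrum_eq:
  assumes "distinct vs" "set vs = pverts G"
  shows "graph_spectrum G = proots (char_poly (adjacency_matrix G vs))"
proof -
  define us where "us = (SOME vs. distinct vs \<and> set vs = pverts G)"
  have "distinct us \<and> set us = pverts G"
    unfolding us_def by (rule someI[of _ vs]) (simp add: assms)
  then have "char_poly (adjacency_matrix G us) = char_poly (adjacency_matrix G vs)"
    using assms by (metis char_poly_adjacency_matrix_unique)
  then show ?thesis unfolding graph_spectrum_def us_def by simp
qed

lemma pair_graph_triangular_graph: "pair_graph (triangular_graph n)"
proof -
  define V where "V = (SIGMA i : {1..n}. {1..i})"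
  have fin: "finite V" unfolding V_def by auto
  have "parcs (triangular_graph n) \<subseteq> V \<times> V"
    by (auto simp: triangular_graph_def V_def Let_def)
  then have "finite (parcs (triangular_graph n))"
    using fin by (meson finite_SigmaI finite_subset)
  moreover have "finite (pverts (triangular_graph n))"
    by (auto simp: triangular_graph_def Let_def)
  moreover have "sym (parcs (triangular_graph n))"
    by (rule symI) (auto simp: triangular_graph_def Let_def)
  ultimately show ?thesis
    by unfold_locales (auto simp: symmetric_def, auto simp: triangular_graph_def Let_def)
qed

lemma card_pverts_triangular_graph: "card (pverts (triangular_graph n)) = triangular_number n"
proof -
  have "card (pverts (triangular_graph n)) = (\<Sum>i\<in>{1..n}. i)"
    by (simp add: triangular_graph_def Let_def)
  also have "\<dots> = triangular_number n"
    by (simp add: Sum_Icc_nat triangular_number_def)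
  finally show ?thesis .
qed

lemma complete_digraph_complete_graph: "complete_digraph m (with_proj (complete_graph m))"
proof -
  have "pverts (complete_graph m) = {..<m}"
    "parcs (complete_graph m) = {(u, v). u < m \<and> v < m \<and> u \<noteq> v}"
    by (simp_all add: complete_graph_def)
  then show ?thesis
    unfolding complete_digraph_pair_def by simp
qed

end

theory Submission
  imports Defs
begin

text \<open>
  Use barycentric coordinates: the vertices of the triangular graph are the triples of
  natural numbers with sum \<open>n - 1\<close>, and two of them are adjacent iff they agree in exactly one coordinate.
  So the adjacency relation is ``on a common line'', where there are \<open>n\<close> lines in each of three
  directions. Let \<open>N\<close> be the incidence matrix of the \<open>3 n\<close> lines against the \<open>T(n)\<close> vertices.
  Every vertex is on three lines and two vertices share at most one, hence
  \<open>N\<^sup>T N = A + 3\<close> (\<open>incidence_gram\<close>). Up to powers of \<open>x\<close>, the characteristic polynomial of \<open>N\<^sup>T N\<close> is that of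
  \<open>N N\<^sup>T\<close> (\<open>char_poly_mult_commute\<close>), and this is a matrix of size \<open>3 n\<close> only; the eigenvalue
  \<open>- 3\<close> owes its large multiplicity to the difference in size.

  By symmetry in the directions, \<open>N N\<^sup>T\<close> has three equal diagonal blocks \<open>D\<close>, the line sizes, and six
  equal other blocks \<open>L\<close>, the intersection numbers of lines (\<open>incidence_cogram\<close>). Such a block matrix
  splits into one copy of \<open>D + 2 L\<close> and two copies of \<open>D - L\<close> (\<open>char_poly_block_mat\<close>), which
  explains the multiplicities 3 and 2.

  Both \<open>n \<times> n\<close> matrices turn out to have \<open>n\<close> distinct integer eigenvalues. They have a
  nested structure: deleting the first and the last position gives the same matrix
  for \<open>n - 2\<close>, plus the identity. Eigenvectors with entries summing to zero therefore extend by
  zeros (\<open>line_eigenfunction_shift\<close>), and each size contributes at most two new ones, for the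
  eigenvalues \<open>n\<close> and 1. Besides these, \<open>D - L\<close>, a graph Laplacian, has the eigenvalue 0, and
  \<open>D + 2 L\<close> has 0 and \<open>2 n + 1\<close>. This yields all
  of \<open>0, ..., n\<close> except one middle number for \<open>D - L\<close>, and all of \<open>1, ..., n\<close> except two middle
  numbers, together with 0 and \<open>2 n + 1\<close>, for \<open>D + 2 L\<close>
  (\<open>char_poly_line_mat_laplacian\<close>, \<open>char_poly_line_mat_quotient\<close>).
\<close>

section \<open>Characteristic polynomials\<close>

lemma char_poly_four_block_mat_lower_left_zero:
  fixes A1 :: "'a :: idom mat"
  assumes A1: "A1 \<in> carrier_mat n n" and A2: "A2 \<in> carrier_mat n m"
    and A4: "A4 \<in> carrier_mat m m"
  shows "char_poly (four_block_mat A1 A2 (0\<^sub>m m n) A4) = char_poly A1 * char_poly A4"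
proof -
  let ?cm = "\<lambda>A. [:0, 1:] \<cdot>\<^sub>m 1\<^sub>m (dim_row A) + map_mat (\<lambda>a. [:- a:]) A"
  have "char_poly (four_block_mat A1 A2 (0\<^sub>m m n) A4) = det (?cm (four_block_mat A1 A2 (0\<^sub>m m n) A4))"
    unfolding char_poly_defs ..
  also have "?cm (four_block_mat A1 A2 (0\<^sub>m m n) A4)
      = four_block_mat (?cm A1) (map_mat (\<lambda>a. [:- a:]) A2) (0\<^sub>m m n) (?cm A4)"
    by (rule eq_matI, insert A1 A2 A4, auto simp: one_poly_def)
  also have "det \<dots> = det (?cm A1) * det (?cm A4)"
    by (rule det_four_block_mat_lower_left_zero[OF _ _ refl], insert A1 A2 A4, auto)
  also have "\<dots> = char_poly A1 * char_poly A4" unfolding char_poly_defs ..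
  finally show ?thesis .
qed

lemma char_poly_four_block_mat_upper_right_zero:
  fixes A1 :: "'a :: idom mat"
  assumes A1: "A1 \<in> carrier_mat n n" and A3: "A3 \<in> carrier_mat m n"
    and A4: "A4 \<in> carrier_mat m m"
  shows "char_poly (four_block_mat A1 (0\<^sub>m n m) A3 A4) = char_poly A1 * char_poly A4"
proof -
  have "char_poly (four_block_mat A1 (0\<^sub>m n m) A3 A4)
      = char_poly (transpose_mat (four_block_mat A1 (0\<^sub>m n m) A3 A4))"
    using A1 A4 by (intro char_poly_transpose_mat[symmetric, where n = "n + m"]) auto
  also have "transpose_mat (four_block_mat A1 (0\<^sub>m n m) A3 A4)
      = four_block_mat (transpose_mat A1) (transpose_mat A3) (0\<^sub>m m n) (transpose_mat A4)"
    by (subst transpose_four_block_mat[OF A1 _ A3 A4]) auto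
  also have "char_poly \<dots> = char_poly (transpose_mat A1) * char_poly (transpose_mat A4)"
    using A1 A3 A4 by (intro char_poly_four_block_mat_lower_left_zero) auto
  finally show ?thesis using A1 A4 by simp
qed

lemma char_poly_zero_mat: "char_poly (0\<^sub>m n n :: 'a :: comm_ring_1 mat) = [:0, 1:] ^ n"
proof -
  have "char_poly (0\<^sub>m n n :: 'a mat) = (\<Prod>a\<leftarrow>diag_mat (0\<^sub>m n n :: 'a mat). [:- a, 1:])"
    by (rule char_poly_upper_triangular) auto
  also have "diag_mat (0\<^sub>m n n :: 'a mat) = replicate n 0"
    by (auto simp: diag_mat_def intro: nth_equalityI)
  finally show ?thesis by simp
qed

text \<open>
  The two block triangular matrices \<open>(A B, 0; B, 0)\<close> and \<open>(0, 0; B, B A)\<close> are conjugate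
  through the unipotent matrix \<open>(1, A; 0, 1)\<close>, and their characteristic polynomials are read off
  from the diagonal blocks.
\<close>

lemma char_poly_mult_commute:
  fixes A :: "'a :: idom mat"
  assumes A: "A \<in> carrier_mat n m" and B: "B \<in> carrier_mat m n"
  shows "[:0, 1:] ^ m * char_poly (A * B) = [:0, 1:] ^ n * char_poly (B * A)"
proof -
  let ?X = "four_block_mat (A * B) (0\<^sub>m n m) B (0\<^sub>m m m)"
  let ?Y = "four_block_mat (0\<^sub>m n n) (0\<^sub>m n m) B (B * A)"
  let ?P = "four_block_mat (1\<^sub>m n) A (0\<^sub>m m n) (1\<^sub>m m)"
  let ?Q = "four_block_mat (1\<^sub>m n) (- A) (0\<^sub>m m n) (1\<^sub>m m)"
  have carr: "{?X, ?Y, ?P, ?Q} \<subseteq> carrier_mat (n + m) (n + m)" using A B by auto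
  note block_mult = mult_four_block_mat[where ?nr1.0 = n and ?n1.0 = n and ?n2.0 = m
      and ?nr2.0 = m and ?nc1.0 = n and ?nc2.0 = m]
  have PQ: "?P * ?Q = 1\<^sub>m (n + m)"
    by (subst block_mult)
      (use A in \<open>auto simp flip: four_block_one_mat intro!: cong_four_block_mat\<close>)
  have QP: "?Q * ?P = 1\<^sub>m (n + m)"
    by (subst block_mult)
      (use A in \<open>auto simp: add_uminus_minus_mat[of A n m] simp flip: four_block_one_mat intro!: cong_four_block_mat\<close>)
  have "?X * ?P = four_block_mat (A * B) (A * B * A) B (B * A)"
    by (subst block_mult)
      (use A B in auto)
  also have "\<dots> = ?P * ?Y"
    by (subst block_mult)
      (use A B in auto)
  finally have comm: "?X * ?P = ?P * ?Y" .
  have "?X = ?X * (?P * ?Q)" using carr unfolding PQ by (intro right_mult_one_mat[symmetric]) auto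
  also have "\<dots> = ?X * ?P * ?Q" using carr by (intro assoc_mult_mat[symmetric]) auto
  finally have "?X = ?P * ?Y * ?Q" unfolding comm .
  then have "similar_mat ?X ?Y" by (rule similar_matI[OF carr PQ QP])
  then have "char_poly ?X = char_poly ?Y" by (rule char_poly_similar)
  moreover have "char_poly ?X = char_poly (A * B) * char_poly (0\<^sub>m m m)"
    using A B by (intro char_poly_four_block_mat_upper_right_zero) auto
  moreover have "char_poly ?Y = char_poly (0\<^sub>m n n) * char_poly (B * A)"
    using A B by (intro char_poly_four_block_mat_upper_right_zero) auto
  ultimately show ?thesis by (simp add: char_poly_zero_mat mult.commute)
qed

lemma char_poly_add_scalar:
  fixes A :: "'a :: {field, ring_char_0} mat"
  assumes A: "A \<in> carrier_mat n n" and E: "char_poly A = (\<Prod>e\<in>#E. [:- e, 1:])"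
  shows "char_poly (A + c \<cdot>\<^sub>m 1\<^sub>m n) = (\<Prod>e\<in>#E. [:- (e + c), 1:])"
proof (rule poly_eq_poly_eq_iff[THEN iffD1], rule ext)
  fix x
  have "poly (char_poly (A + c \<cdot>\<^sub>m 1\<^sub>m n)) x = poly (char_poly A) (x - c)"
    using A by (subst (1 2) char_poly_matrix[where n = n])
      (auto simp: char_matrix_def intro!: arg_cong[where f = det] eq_matI)
  also have "\<dots> = poly (\<Prod>e\<in>#E. [:- (e + c), 1:]) x"
    unfolding E by (induction E) (auto simp: algebra_simps)
  finally show "poly (char_poly (A + c \<cdot>\<^sub>m 1\<^sub>m n)) x = poly (\<Prod>e\<in>#E. [:- (e + c), 1:]) x" .
qed

text \<open>
  This is how multiplicities are controlled without any linear independence argument: a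
  monic polynomial of degree \<open>n\<close> with \<open>n\<close> distinct roots is the product of its linear factors,
  so a nonzero eigenvector for each of \<open>n\<close> distinct numbers is enough.
\<close>

lemma char_poly_eq_prod_distinct_eigenvalues:
  fixes A :: "'a :: field mat"
  assumes A: "A \<in> carrier_mat n n" and "finite S" "card S = n"
    and ev: "\<And>e. e \<in> S \<Longrightarrow> eigenvalue A e"
  shows "char_poly A = (\<Prod>e\<in>S. [:- e, 1:])"
proof -
  have deg: "degree (\<Prod>e\<in>S. [:- e, 1:]) = n" 
    using assms by (subst degree_prod_eq_sum_degree) auto
  have "lead_coeff (\<Prod>e\<in>S. [:- e, 1:]) = 1"
    by (simp add: lead_coeff_prod)
  with deg show ?thesis
    using degree_monic_char_poly[OF A] assms
    by (intro poly_eqI_degree_lead_coeff[where A = S and n = n])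
      (auto simp: eigenvalue_root_char_poly[OF A] poly_prod)
qed

lemma proots_prod_linear:
  "proots (\<Prod>e\<in>#E. [:- e, 1:]) = (E :: 'a :: idom multiset)"
proof (induction E)
  case (add x E)
  have "proots ([:- x, 1:] * (\<Prod>e\<in>#E. [:- e, 1:])) = proots [:- x, 1:] + proots (\<Prod>e\<in>#E. [:- e, 1:])"
    by (intro proots_mult) (auto simp: prod_mset_zero_iff)
  with add show ?case by (simp del: mult_pCons_left)
qed simp

section \<open>Matrices with three equal diagonal blocks\<close>

lemma sum_blocks_3: "(\<Sum>p<3 * n. f p) = (\<Sum>a<n. f a + f (n + a) + f (2 * n + a))"
  for f :: "nat \<Rightarrow> 'a :: comm_monoid_add"
proof -
  have split: "(\<Sum>p<m + k. g p) = (\<Sum>p<m. g p) + (\<Sum>p<k. g (m + p))" for m k and g :: "nat \<Rightarrow> 'a"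
    by (induction k) (auto simp: add.assoc)
  have "3 * n = n + (n + n)" by simp
  then show ?thesis
    by (simp only: split) (simp add: sum.distrib add_ac mult_2)
qed

text \<open>
  Row \<open>t * n + a\<close> is the \<open>a\<close>-th row of the \<open>t\<close>-th block, so \<open>p div n\<close> selects the block and
  \<open>p mod n\<close> the position in it. The three diagonal blocks are \<open>D\<close>, the six others are \<open>L\<close>.
\<close>

definition block_mat :: "nat \<Rightarrow> (nat \<Rightarrow> nat \<Rightarrow> 'a) \<Rightarrow> (nat \<Rightarrow> nat \<Rightarrow> 'a) \<Rightarrow> 'a mat" where
  "block_mat n D L = mat (3 * n) (3 * n)
    (\<lambda>(p, q). (if p div n = q div n then D else L) (p mod n) (q mod n))"

text \<open>
  On the vectors \<open>(u, u, u)\<close> the block matrix acts as \<open>D + 2 L\<close>, and modulo these vectors it acts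
  as \<open>D - L\<close> on each of the two remaining blocks. In the basis consisting of the vectors
  \<open>(u, u, u)\<close> and of the second and third block it is therefore block triangular. The base change
  is the shear that adds the first block to the other two; its inverse subtracts it.
\<close>

lemma char_poly_block_mat:
  fixes D L :: "nat \<Rightarrow> nat \<Rightarrow> 'a :: idom"
  shows "char_poly (block_mat n D L)
    = char_poly (mat n n (\<lambda>(a, b). D a b + 2 * L a b)) * char_poly (mat n n (\<lambda>(a, b). D a b - L a b)) ^ 2"
proof (cases "n = 0")
  case True
  have "char_poly (mat 0 0 f :: 'a mat) = 1" for f
  proof -
    have "mat 0 0 f = (0\<^sub>m 0 0 :: 'a mat)" by auto
    then show ?thesis using char_poly_zero_mat[of 0, where 'a = 'a] by simp
  qed
  with True show ?thesis by (simp add: block_mat_def)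
next
  case False
  then have n: "n > 0" by simp
  let ?M = "block_mat n D L"
  let ?U = "mat n n (\<lambda>(a, b). D a b + 2 * L a b)" and ?W = "mat n n (\<lambda>(a, b). D a b - L a b)"
  let ?K = "mat n (2 * n) (\<lambda>(a, q). L a (q mod n))"
  let ?WW = "four_block_mat ?W (0\<^sub>m n n) (0\<^sub>m n n) ?W"
  let ?T = "four_block_mat ?U ?K (0\<^sub>m (2 * n) n) ?WW"
  define shear where "shear c = mat (3 * n) (3 * n)
    (\<lambda>(p, q). if p = q then 1 else if q < n \<and> p mod n = q then c else 0)" for c :: 'a
  have carr [simp]: "?T \<in> carrier_mat (3 * n) (3 * n)" "?M \<in> carrier_mat (3 * n) (3 * n)"
      "shear c \<in> carrier_mat (3 * n) (3 * n)" for c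
    by (auto simp: block_mat_def shear_def)
  have shear_mult: "(shear c * X) $$ (p, q) = X $$ (p, q) + (if p < n then 0 else c * X $$ (p mod n, q))"
    if "X \<in> carrier_mat (3 * n) (3 * n)" "p < 3 * n" "q < 3 * n" for c X p q
  proof -
    have "(shear c * X) $$ (p, q) = (\<Sum>k<3 * n. shear c $$ (p, k) * X $$ (k, q))"
      using that by (auto simp: scalar_prod_def shear_def atLeast0LessThan)
    also have "\<dots> = (\<Sum>k<3 * n. (if k = p then X $$ (k, q) else 0)
        + (if k = p mod n then (if p < n then 0 else c * X $$ (k, q)) else 0))"
      using that n mod_less_divisor[OF n, of p]
      by (intro sum.cong refl) (auto simp: shear_def simp del: mod_less_divisor)
    also have "\<dots> = X $$ (p, q) + (if p < n then 0 else c * X $$ (p mod n, q))"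
    proof -
      have "p mod n < 3 * n" using n by (simp add: order_less_le_trans[OF mod_less_divisor])
      then show ?thesis using that by (simp add: sum.distrib)
    qed
    finally show ?thesis .
  qed
  have shear_index: "shear c $$ (p, q) = (if p = q then 1 else if q < n \<and> p mod n = q then c else 0)"
    if "p < 3 * n" "q < 3 * n" for c p q
    using that by (simp add: shear_def)
  have shear_inv: "shear c * shear (- c) = 1\<^sub>m (3 * n)" for c
  proof (rule eq_matI)
    fix p q assume "p < dim_row (1\<^sub>m (3 * n) :: 'a mat)" "q < dim_col (1\<^sub>m (3 * n) :: 'a mat)"
    then have pq: "p < 3 * n" "q < 3 * n" by auto
    have m: "p mod n < 3 * n" "p mod n < n" using n by (auto simp: order_less_le_trans[OF mod_less_divisor])
    show "(shear c * shear (- c)) $$ (p, q) = 1\<^sub>m (3 * n) $$ (p, q)"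
      unfolding shear_mult[OF carr(3) pq] shear_index[OF pq] shear_index[OF m(1) pq(2)]
      using pq m(2) by auto
  qed (auto simp: shear_def)
  have "?M * shear 1 = shear 1 * ?T"
  proof (rule eq_matI)
    fix p q assume "p < dim_row (shear 1 * ?T)" "q < dim_col (shear 1 * ?T)"
    then have pq: "p < 3 * n" "q < 3 * n" by (auto simp: shear_def)
    \<comment> \<open>On the right, the shear sums the three block columns into the first one.\<close>
    have left: "(?M * shear 1) $$ (p, q)
        = (if q < n then D (p mod n) q + 2 * L (p mod n) q else ?M $$ (p, q))"
    proof -
      have "(?M * shear 1) $$ (p, q) = (\<Sum>k<3 * n. ?M $$ (p, k) * shear 1 $$ (k, q))"
        using pq by (auto simp: scalar_prod_def shear_def atLeast0LessThan block_mat_def)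
      also have "\<dots> = (if q < n then D (p mod n) q + 2 * L (p mod n) q else ?M $$ (p, q))"
      proof (cases "q < n")
        case True
        have "p div n < 3" using pq by (simp add: less_mult_imp_div_less)
        then consider "p div n = 0" | "p div n = 1" | "p div n = 2" by linarith
        then have row: "?M $$ (p, q) + ?M $$ (p, n + q) + ?M $$ (p, 2 * n + q) = D (p mod n) q + 2 * L (p mod n) q"
          using pq n True by cases (auto simp: block_mat_def)
        have "(\<Sum>k<3 * n. ?M $$ (p, k) * shear 1 $$ (k, q))
            = (\<Sum>a<n. if a = q then ?M $$ (p, a) + ?M $$ (p, n + a) + ?M $$ (p, 2 * n + a) else 0)"
          unfolding sum_blocks_3 using True n by (intro sum.cong refl) (auto simp: shear_def)
        also have "\<dots> = D (p mod n) q + 2 * L (p mod n) q" using True by (simp add: row)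
        finally show ?thesis using True by simp
      next
        case False
        have "(\<Sum>k<3 * n. ?M $$ (p, k) * shear 1 $$ (k, q)) = (\<Sum>k<3 * n. if k = q then ?M $$ (p, k) else 0)"
          using False pq by (intro sum.cong refl) (auto simp: shear_def)
        then show ?thesis using False pq by simp
      qed
      finally show ?thesis .
    qed
    have right: "(shear 1 * ?T) $$ (p, q) = ?T $$ (p, q) + (if p < n then 0 else ?T $$ (p mod n, q))"
      using pq by (simp add: shear_mult)
    have div1: "r div n = 1" "r mod n = r - n" if "n \<le> r" "r < 2 * n" for r
      using that by (simp_all add: le_div_geq le_mod_geq)
    have div2: "r div n = 2" "r mod n = r - 2 * n" "(r - n) mod n = r - 2 * n" "\<not> r - n < n" "r - (n + n) = r - 2 * n"
      if "2 * n \<le> r" "r < 3 * n" for r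
      using that n by (simp_all add: le_div_geq le_mod_geq)
    have "p < n \<or> n \<le> p \<and> p < 2 * n \<or> 2 * n \<le> p" "q < n \<or> n \<le> q \<and> q < 2 * n \<or> 2 * n \<le> q"
      by linarith+
    then show "(?M * shear 1) $$ (p, q) = (shear 1 * ?T) $$ (p, q)"
      unfolding left right using pq n
      by (elim disjE) (auto simp: block_mat_def div1 div2)
  qed (auto simp: shear_def block_mat_def)
  then have "?M * shear 1 * shear (- 1) = shear 1 * ?T * shear (- 1)" by simp
  moreover have "?M * shear 1 * shear (- 1) = ?M * (shear 1 * shear (- 1))"
    by (rule assoc_mult_mat[OF carr(2,3,3)])
  ultimately have "?M = shear 1 * ?T * shear (- 1)"
    by (simp add: shear_inv right_mult_one_mat[of _ "3 * n"])
  moreover have "shear (- 1) * shear 1 = 1\<^sub>m (3 * n)" using shear_inv[of "- 1"] by simp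
  ultimately have "similar_mat ?M ?T"
    using carr by (intro similar_matI[OF _ shear_inv[of 1]]) simp_all
  then have "char_poly ?M = char_poly ?T" by (rule char_poly_similar)
  also have "\<dots> = char_poly ?U * char_poly ?WW"
    by (rule char_poly_four_block_mat_lower_left_zero) auto
  also have "char_poly ?WW = char_poly ?W * char_poly ?W"
    by (rule char_poly_four_block_mat_lower_left_zero) auto
  finally show ?thesis by (simp add: power2_eq_square)
qed

section \<open>The eigenvalues of the line matrices\<close>

text \<open>
  This is \<open>D + c L\<close>, where \<open>D\<close> is the diagonal matrix of the line sizes \<open>n - a\<close> and the entry
  of \<open>L\<close> at \<open>(a, b)\<close> tells whether two lines \<open>a\<close> and \<open>b\<close> of different directions meet in the
  triangle. Only \<open>c = 2\<close> and \<open>c = - 1\<close> matter. For \<open>c = - 1\<close> the matrix is the Laplacian of the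
  threshold graph on \<open>0, ..., n - 1\<close> in which distinct \<open>a\<close> and \<open>b\<close> are adjacent iff \<open>a + b < n\<close>;
  for \<open>c = 2\<close> it is the quotient matrix for the lines of all three directions.
\<close>

definition line_mat :: "nat \<Rightarrow> real \<Rightarrow> real mat" where
  "line_mat n c = mat n n (\<lambda>(a, b). (if a = b then real (n - a) else 0) + c * of_bool (a + b < n))"

text \<open>
  The eigenvector equation for \<open>line_mat n c\<close>, with the vector given as a function; row \<open>a\<close> of \<open>L\<close>
  has its ones exactly at the positions below \<open>n - a\<close>.
\<close>

definition line_eigenfunction :: "nat \<Rightarrow> real \<Rightarrow> real \<Rightarrow> (nat \<Rightarrow> real) \<Rightarrow> bool" where
  "line_eigenfunction n c e f \<longleftrightarrow>
    (\<exists>a<n. f a \<noteq> 0) \<and> (\<forall>a<n. real (n - a) * f a + c * (\<Sum>b<n - a. f b) = e * f a)"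

lemma eigenvalue_line_mat:
  assumes "line_eigenfunction n c e f"
  shows "eigenvalue (line_mat n c) e"
proof -
  have "(line_mat n c *\<^sub>v vec n f) $ a = e * f a" if a: "a < n" for a
  proof -
    have "(line_mat n c *\<^sub>v vec n f) $ a
        = (\<Sum>b<n. ((if a = b then real (n - a) else 0) + c * of_bool (a + b < n)) * f b)"
      using a by (simp add: line_mat_def scalar_prod_def atLeast0LessThan)
    also have "\<dots> = (\<Sum>b<n. (if a = b then real (n - a) * f b else 0)) + c * (\<Sum>b<n. if b < n - a then f b else 0)"
      unfolding sum_distrib_left sum.distrib[symmetric] by (intro sum.cong) (auto simp: algebra_simps)
    also have "(\<Sum>b<n. (if a = b then real (n - a) * f b else 0)) = real (n - a) * f a"
      using a by simp
    also have "(\<Sum>b<n. if b < n - a then f b else 0) = (\<Sum>b<n - a. f b)"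
      by (rule sum.mono_neutral_cong_right) auto
    finally show ?thesis using assms a by (simp add: line_eigenfunction_def)
  qed
  then have "line_mat n c *\<^sub>v vec n f = e \<cdot>\<^sub>v vec n f"
    by (intro eq_vecI) (auto simp: line_mat_def)
  moreover have "vec n f \<noteq> 0\<^sub>v n"
    using assms by (auto simp: line_eigenfunction_def vec_eq_iff)
  ultimately show ?thesis
    unfolding eigenvalue_def eigenvector_def by (intro exI[of _ "vec n f"]) (simp add: line_mat_def)
qed

text \<open>
  Place the function on the middle \<open>m\<close> of \<open>m + 2 k\<close> positions. A row of the first \<open>k\<close> sees
  the whole sum of \<open>f\<close>, which is zero, and a row of the last \<open>k\<close> sees only positions below \<open>k\<close>.
  On the middle rows \<open>L\<close> is unchanged, as \<open>(k + a) + (k + b) < m + 2 k\<close> iff \<open>a + b < m\<close>, while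
  the line sizes grow by \<open>k\<close>, and with them the eigenvalue. So it suffices to find,
  for every size, the eigenvectors that are not obtained from a smaller size.
\<close>

lemma line_eigenfunction_shift:
  assumes f: "line_eigenfunction m c e f" and zero: "(\<Sum>b<m. f b) = 0"
  shows "line_eigenfunction (m + 2 * k) c (e + real k) (\<lambda>a. if k \<le> a \<and> a < k + m then f (a - k) else 0)"
    (is "line_eigenfunction ?n _ _ ?g")
proof -
  have split: "(\<Sum>b<k + N. ?g b) = (\<Sum>b<N. if b < m then f b else 0)" for N
    by (induction N) auto
  have "real (?n - a) * ?g a + c * (\<Sum>b<?n - a. ?g b) = (e + real k) * ?g a" if "a < ?n" for a
  proof -
    consider "a < k" | a' where "a = k + a'" "a' < m" | "k + m \<le> a"
      by (metis add_less_cancel_left le_add_diff_inverse not_less)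
    then show ?thesis
    proof cases
      case 1
      then have "?n - a = k + (m + (k - a))" by simp
      then have "(\<Sum>b<?n - a. ?g b) = (\<Sum>b<m + (k - a). if b < m then f b else 0)"
        by (simp only: split)
      also have "\<dots> = (\<Sum>b<m. f b)" by (rule sum.mono_neutral_cong_right) auto
      finally show ?thesis using 1 zero by simp
    next
      case 2
      then have "?n - a = k + (m - a')" by simp
      then have "(\<Sum>b<?n - a. ?g b) = (\<Sum>b<m - a'. if b < m then f b else 0)"
        by (simp only: split)
      also have "\<dots> = (\<Sum>b<m - a'. f b)" by (rule sum.cong) auto
      moreover have "real (m - a') * f a' + c * (\<Sum>b<m - a'. f b) = e * f a'"
        using f 2 by (simp add: line_eigenfunction_def)
      moreover have "real (?n - a) = real (m - a') + real k" using 2 by simp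
      ultimately show ?thesis using 2 by (simp add: algebra_simps)
    next
      case 3
      have "(\<Sum>b<?n - a. ?g b) = 0" using 3 by (intro sum.neutral) auto
      then show ?thesis using 3 by simp
    qed
  qed
  moreover obtain a where "a < m" "f a \<noteq> 0" using f by (auto simp: line_eigenfunction_def)
  then have "k + a < ?n" "?g (k + a) \<noteq> 0" by auto
  ultimately show ?thesis unfolding line_eigenfunction_def by blast
qed

lemma eigenvalue_line_mat_shift:
  assumes "line_eigenfunction (n - 2 * k) c e f" "(\<Sum>b<n - 2 * k. f b) = 0" "2 * k \<le> n"
  shows "eigenvalue (line_mat n c) (e + real k)"
  using eigenvalue_line_mat[OF line_eigenfunction_shift[OF assms(1,2), of k]] assms(3) by simp

text \<open>
  Position 0 of the threshold graph is adjacent to all others, and a dominating vertex always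
  gives the Laplacian eigenvalue \<open>m\<close>.
\<close>

lemma line_eigenfunction_laplacian_top:
  fixes m :: nat
  assumes "m \<ge> 2"
  defines "f \<equiv> \<lambda>a. if a = 0 then real m - 1 else -1"
  shows "line_eigenfunction m (-1) (real m) f" and "(\<Sum>b<m. f b) = 0"
proof -
  have sum: "(\<Sum>b<N. f b) = real m - real N" if "N \<ge> 1" for N
    using that by (induction N rule: dec_induct) (auto simp: f_def)
  then show "(\<Sum>b<m. f b) = 0" using assms(1) by simp
  have "real (m - a) * f a + (-1) * (\<Sum>b<m - a. f b) = real m * f a" if "a < m" for a
    using that sum[of "m - a"] by (auto simp: f_def of_nat_diff)
  moreover have "f 0 \<noteq> 0" using assms(1) by (simp add: f_def)
  ultimately show "line_eigenfunction m (-1) (real m) f"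
    using assms(1) unfolding line_eigenfunction_def by (metis gr0I not_numeral_le_zero)
qed

text \<open>
  The last position of the threshold graph is a pendant vertex at position 0. Without position 0
  it is isolated, so the vector that is constant on it and on the other vertices, with
  sum zero, is in the kernel of the smaller Laplacian; joining position 0 adds 1.
\<close>

lemma line_eigenfunction_laplacian_one:
  fixes m :: nat
  assumes "m \<ge> 3"
  defines "f \<equiv> \<lambda>a. if a = 0 then 0 else if a = m - 1 then 2 - real m else 1"
  shows "line_eigenfunction m (-1) 1 f" and "(\<Sum>b<m. f b) = 0"
proof -
  have sum: "(\<Sum>b<N. f b) = real N - 1" if "N \<ge> 1" "N < m" for N
    using that by (induction N rule: dec_induct) (auto simp: f_def)
  have "{..<m} = insert (m - 1) {..<m - 1}" using assms(1) by auto
  then have "(\<Sum>b<m. f b) = f (m - 1) + (\<Sum>b<m - 1. f b)" by simp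
  then show total: "(\<Sum>b<m. f b) = 0" 
    using assms(1) sum[of "m - 1"] by (simp add: f_def of_nat_diff)
  have "real (m - a) * f a + (-1) * (\<Sum>b<m - a. f b) = 1 * f a" if "a < m" for a
    using that sum[of "m - a"] assms(1) total by (cases "a = 0") (auto simp: f_def of_nat_diff)
  moreover have "f 1 \<noteq> 0" using assms(1) by (simp add: f_def)
  moreover have "1 < m" using assms(1) by simp
  ultimately show "line_eigenfunction m (-1) 1 f" unfolding line_eigenfunction_def by blast
qed

text \<open>
  Subtracting row \<open>a + 1\<close> of the eigenvector equation from row \<open>a\<close> leaves a relation between
  the values at \<open>a\<close>, \<open>a + 1\<close> and \<open>m - 1 - a\<close> only. Here it reads
  \<open>a f(a) - (a + 1) f(a + 1) = 2 f(m - 1 - a)\<close>, whose affine solutions away from 0 are the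
  multiples of \<open>2 m - 1 - 3 a\<close>; the value at 0 makes the total vanish. For \<open>m = 2\<close> the
  function would be zero.
\<close>

lemma line_eigenfunction_quotient_top:
  fixes m :: nat
  assumes "m \<ge> 3"
  defines "f \<equiv> \<lambda>a. if a = 0 then - (real m - 1) * (real m - 2) / 2 else 2 * real m - 1 - 3 * real a"
  shows "line_eigenfunction m 2 (real m) f" and "(\<Sum>b<m. f b) = 0"
proof -
  have sum: "(\<Sum>b<N. f b) = (real m - real N) * (3 * real N - real m - 1) / 2" if "N \<ge> 1" for N
    using that by (induction N rule: dec_induct) (auto simp: f_def field_simps)
  then show "(\<Sum>b<m. f b) = 0" using assms(1) sum[of m] by simp
  have "real (m - a) * f a + 2 * (\<Sum>b<m - a. f b) = real m * f a" if "a < m" for a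
    using that sum[of "m - a"] by (auto simp: f_def of_nat_diff field_simps)
  moreover have "f 0 \<noteq> 0" using assms(1) by (simp add: f_def)
  ultimately show "line_eigenfunction m 2 (real m) f"
    using assms(1) unfolding line_eigenfunction_def by (metis gr0I not_numeral_le_zero)
qed

text \<open>
  The same row differences, now with eigenvalue 1, force the value 0 at position 0 and have the
  affine solutions \<open>m - 3 a\<close> strictly between the two ends; the value at the last position makes the total
  vanish. For \<open>m = 3\<close> the function would be zero.
\<close>

lemma line_eigenfunction_quotient_one:
  fixes m :: nat
  assumes "m \<ge> 4"
  defines "f \<equiv> \<lambda>a. if a = 0 then 0 else if a = m - 1 then (real m - 2) * (real m - 3) / 2
                    else real m - 3 * real a"
  shows "line_eigenfunction m 2 1 f" and "(\<Sum>b<m. f b) = 0"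
proof -
  have sum: "(\<Sum>b<N. f b) = (real N - 1) * (2 * real m - 3 * real N) / 2" if "N \<ge> 1" "N < m" for N
    using that by (induction N rule: dec_induct) (auto simp: f_def field_simps)
  have "{..<m} = insert (m - 1) {..<m - 1}" using assms(1) by auto
  then have "(\<Sum>b<m. f b) = f (m - 1) + (\<Sum>b<m - 1. f b)" by simp
  then show total: "(\<Sum>b<m. f b) = 0" 
    using assms(1) sum[of "m - 1"] by (simp add: f_def of_nat_diff field_simps)
  have "real (m - a) * f a + 2 * (\<Sum>b<m - a. f b) = 1 * f a" if "a < m" for a
    using that sum[of "m - a"] assms(1) total by (cases "a = 0") (auto simp: f_def of_nat_diff field_simps)
  moreover have "f 1 \<noteq> 0 \<or> f 2 \<noteq> 0" using assms(1) by (simp add: f_def)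
  moreover have "1 < m" "2 < m" using assms(1) by auto
  ultimately show "line_eigenfunction m 2 1 f" unfolding line_eigenfunction_def by blast
qed

lemma line_eigenfunction_laplacian_const:
  assumes "n \<ge> 1"
  shows "line_eigenfunction n (-1) 0 (\<lambda>a. 1)"
  using assms by (auto simp: line_eigenfunction_def intro!: exI[of _ 0])

text \<open>
  The line sizes are the image of the all-ones vector of the vertices under the incidence
  matrix, so the degree \<open>2 n - 2\<close> of the regular graph, increased by 3, reappears here.
\<close>

lemma line_eigenfunction_quotient_size:
  assumes "n \<ge> 1"
  shows "line_eigenfunction n 2 (2 * real n + 1) (\<lambda>a. real n - real a)"
proof -
  have sum: "(\<Sum>b<N. real n - real b) = real N * (2 * real n - real N + 1) / 2" for N
    by (induction N) (auto simp: field_simps)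
  show ?thesis using assms
    by (auto simp: line_eigenfunction_def sum of_nat_diff field_simps intro!: exI[of _ 0])
qed

text \<open>
  The three coordinates of a vertex sum to \<open>n - 1\<close>, so \<open>3 a - (n - 1)\<close>, added over the three
  lines through a vertex, gives 0.
\<close>

lemma line_eigenfunction_quotient_kernel:
  assumes "n \<ge> 2"
  shows "line_eigenfunction n 2 0 (\<lambda>a. 3 * real a - (real n - 1))"
proof -
  have sum: "(\<Sum>b<N. 3 * real b - (real n - 1)) = real N * (3 * real N - 1 - 2 * real n) / 2" for N
    by (induction N) (auto simp: field_simps)
  have "real (n - a) * (3 * real a - (real n - 1)) + 2 * (\<Sum>b<n - a. 3 * real b - (real n - 1)) = 0"
    if "a < n" for a
    unfolding sum using that by (simp add: of_nat_diff field_simps)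
  then show ?thesis using assms
    by (auto simp: line_eigenfunction_def intro!: exI[of _ 0])
qed

text \<open>
  With \<open>m = n - 2 k\<close>, the shifted eigenvalue \<open>m + k = n - k\<close> covers the numbers above the
  middle and \<open>1 + k\<close> those between 0 and the middle. For the middle number itself, \<open>m\<close> would be
  too small for either eigenfunction.
\<close>

lemma char_poly_line_mat_laplacian:
  assumes "n \<ge> 1"
  shows "char_poly (line_mat n (-1)) = (\<Prod>e\<in>{0..n} - {(n + 1) div 2}. [:- real e, 1:])"
proof -
  let ?S = "{0..n} - {(n + 1) div 2}"
  have "char_poly (line_mat n (-1)) = (\<Prod>e\<in>real ` ?S. [:- e, 1:])"
  proof (rule char_poly_eq_prod_distinct_eigenvalues)
    show "card (real ` ?S) = n"
      by (subst card_image) (auto simp: inj_on_def)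
    fix e assume "e \<in> real ` ?S"
    then obtain i where i: "e = real i" "i \<in> ?S" by (elim imageE)
    then have "i \<le> n" "i \<noteq> (n + 1) div 2" by auto
    note i = this i(1)
    consider "i = 0" | "1 \<le> i" "i < (n + 1) div 2" | "i > (n + 1) div 2" using i by linarith
    then show "eigenvalue (line_mat n (-1)) e"
    proof cases
      case 1
      then show ?thesis
        using eigenvalue_line_mat[OF line_eigenfunction_laplacian_const[OF assms]] i by simp
    next
      case 2
      then have "n - 2 * (i - 1) \<ge> 3" by linarith
      from eigenvalue_line_mat_shift[OF line_eigenfunction_laplacian_one[OF this]]
      show ?thesis using 2 i by (simp add: of_nat_diff)
    next
      case 3
      then have "n - 2 * (n - i) \<ge> 2" using i by linarith
      from eigenvalue_line_mat_shift[OF line_eigenfunction_laplacian_top[OF this]]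
      show ?thesis using 3 i by (simp add: of_nat_diff)
    qed
  qed (auto simp: line_mat_def)
  also have "\<dots> = (\<Prod>e\<in>?S. [:- real e, 1:])"
    by (subst prod.reindex) (auto simp: inj_on_def)
  finally show ?thesis .
qed

text \<open>
  As for the Laplacian, but the eigenfunctions degenerate one step earlier, so that two middle
  numbers are missed; the additional eigenvalues are 0 and \<open>2 n + 1\<close>.
\<close>

lemma char_poly_line_mat_quotient:
  assumes "n \<ge> 2"
  shows "char_poly (line_mat n 2)
    = (\<Prod>e\<in>insert 0 (insert (2 * n + 1) ({1..n} - {n div 2, n div 2 + 1})). [:- real e, 1:])"
proof -
  let ?S = "insert 0 (insert (2 * n + 1) ({1..n} - {n div 2, n div 2 + 1}))"
  have "char_poly (line_mat n 2) = (\<Prod>e\<in>real ` ?S. [:- e, 1:])"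
  proof (rule char_poly_eq_prod_distinct_eigenvalues)
    have "card ({1..n} - {n div 2, n div 2 + 1}) = n - 2"
      using assms by (subst card_Diff_subset) auto
    then show "card (real ` ?S) = n"
      using assms by (subst card_image) (auto simp: inj_on_def)
    fix e assume "e \<in> real ` ?S"
    then obtain i where i: "e = real i" "i \<in> ?S" by (elim imageE)
    then consider "i = 0" | "i = 2 * n + 1" | "1 \<le> i" "i < n div 2" | "i > n div 2 + 1" "i \<le> n"
      by fastforce
    then show "eigenvalue (line_mat n 2) e"
    proof cases
      case 1
      then show ?thesis
        using eigenvalue_line_mat[OF line_eigenfunction_quotient_kernel[OF assms]] i by simp
    next
      case 2
      then show ?thesis
        using eigenvalue_line_mat[OF line_eigenfunction_quotient_size[of n]] i assms by (simp add: algebra_simps)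
    next
      case 3
      then have "n - 2 * (i - 1) \<ge> 4" by linarith
      from eigenvalue_line_mat_shift[OF line_eigenfunction_quotient_one[OF this]]
      show ?thesis using 3 i by (simp add: of_nat_diff)
    next
      case 4
      then have "n - 2 * (n - i) \<ge> 3" using i by linarith
      from eigenvalue_line_mat_shift[OF line_eigenfunction_quotient_top[OF this]]
      show ?thesis using 4 i by (simp add: of_nat_diff)
    qed
  qed (auto simp: line_mat_def)
  also have "\<dots> = (\<Prod>e\<in>?S. [:- real e, 1:])"
    by (subst prod.reindex) (auto simp: inj_on_def)
  finally show ?thesis .
qed

section \<open>Lines and vertices\<close>

text \<open>
  Barycentric coordinates: the three values are nonnegative and sum to \<open>n - 1\<close>, and two vertices
  agree in one of them iff they lie on a common row, column or diagonal. In these coordinates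
  the three directions are interchangeable.
\<close>

fun tri_coord :: "nat \<Rightarrow> nat \<Rightarrow> nat \<times> nat \<Rightarrow> nat" where
  "tri_coord n t (i, j) = (if t = 0 then n - i else if t = 1 then j - 1 else i - j)"

text \<open>
  Row \<open>t * n + a\<close> stands for the line on which coordinate \<open>t\<close> equals \<open>a\<close>; lines with a single
  vertex are included.
\<close>

definition incidence_mat :: "nat \<Rightarrow> (nat \<times> nat) list \<Rightarrow> real mat" where
  "incidence_mat n vs =
    mat (3 * n) (length vs) (\<lambda>(p, k). of_bool (tri_coord n (p div n) (vs ! k) = p mod n))"

lemma pverts_triangular_graph: "pverts (triangular_graph n) = (SIGMA i : {1..n}. {1..i})"
  by (simp add: triangular_graph_def Let_def)

lemma tri_coord_less: "v \<in> pverts (triangular_graph n) \<Longrightarrow> tri_coord n t v < n"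
  by (auto simp: pverts_triangular_graph)

text \<open>
  A vertex lies on three lines. Two distinct vertices share at most one line, because two
  coordinates determine the third.
\<close>

lemma common_lines_eq_adjacency:
  assumes u: "u \<in> pverts (triangular_graph n)" and v: "v \<in> pverts (triangular_graph n)"
  shows "(\<Sum>t<3. of_bool (tri_coord n t u = tri_coord n t v) :: real)
    = of_bool ((u, v) \<in> parcs (triangular_graph n)) + 3 * of_bool (u = v)"
proof -
  obtain i j k l where [simp]: "u = (i, j)" "v = (k, l)" by (cases u, cases v) auto
  have r: "1 \<le> j" "j \<le> i" "i \<le> n" "1 \<le> l" "l \<le> k" "k \<le> n"
    using u v by (auto simp: pverts_triangular_graph)
  have arc: "(u, v) \<in> parcs (triangular_graph n) \<longleftrightarrow> u \<noteq> v \<and> (i = k \<or> j = l \<or> i - j = k - l)"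
    using r by (auto simp: triangular_graph_def Let_def)
  have eqs: "n - i = n - k \<longleftrightarrow> i = k" "j - 1 = l - 1 \<longleftrightarrow> j = l" using r by linarith+
  have "i = k \<Longrightarrow> i - j = k - l \<longleftrightarrow> j = l" "j = l \<Longrightarrow> i - j = k - l \<longleftrightarrow> i = k"
    using r by linarith+
  then show ?thesis
    unfolding arc by (auto simp: eval_nat_numeral eqs[simplified])
qed

lemma incidence_gram:
  assumes vs: "set vs = pverts (triangular_graph n)" "distinct vs"
  shows "transpose_mat (incidence_mat n vs) * incidence_mat n vs
    = adjacency_matrix (triangular_graph n) vs + 3 \<cdot>\<^sub>m 1\<^sub>m (length vs)" (is "?L = ?R")
proof (rule eq_matI)
  fix k l assume "k < dim_row ?R" "l < dim_col ?R"
  then have kl: "k < length vs" "l < length vs" by (auto simp: adjacency_matrix_def)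
  let ?u = "vs ! k" and ?v = "vs ! l"
  have uv: "?u \<in> pverts (triangular_graph n)" "?v \<in> pverts (triangular_graph n)"
    using kl vs(1) nth_mem by auto
  then have n: "n > 0" using tri_coord_less by fastforce
  let ?f = "\<lambda>t a. of_bool (tri_coord n t ?u = a) * of_bool (tri_coord n t ?v = a) :: real"
  have "?L $$ (k, l) = (\<Sum>p<3 * n. ?f (p div n) (p mod n))"
    using kl by (simp add: incidence_mat_def scalar_prod_def atLeast0LessThan)
  also have "\<dots> = (\<Sum>a<n. ?f 0 a + ?f 1 a + ?f 2 a)"
    unfolding sum_blocks_3 by (intro sum.cong refl) auto
  also have "\<dots> = (\<Sum>t<3. \<Sum>a<n. ?f t a)"
    by (simp add: numeral_3_eq_3 numeral_2_eq_2 sum.distrib del: tri_coord.simps)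
  also have "\<dots> = (\<Sum>t<3. of_bool (tri_coord n t ?u = tri_coord n t ?v))"
  proof (rule sum.cong[OF refl])
    fix t
    have "(\<Sum>a<n. ?f t a)
        = (\<Sum>a<n. if a = tri_coord n t ?u then of_bool (tri_coord n t ?u = tri_coord n t ?v) else 0)"
      by (rule sum.cong) auto
    also have "\<dots> = of_bool (tri_coord n t ?u = tri_coord n t ?v)"
      using tri_coord_less[OF uv(1)] by simp
    finally show "(\<Sum>a<n. ?f t a) = of_bool (tri_coord n t ?u = tri_coord n t ?v)" .
  qed
  also have "\<dots> = ?R $$ (k, l)"
    unfolding common_lines_eq_adjacency[OF uv]
    using kl vs(2) by (auto simp: adjacency_matrix_def nth_eq_iff_index_eq)
  finally show "?L $$ (k, l) = ?R $$ (k, l)" .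
qed (auto simp: incidence_mat_def adjacency_matrix_def)

lemma card_line:
  assumes "t < 3" "a < n"
  shows "card {v \<in> pverts (triangular_graph n). tri_coord n t v = a} = n - a"
proof -
  let ?g = "\<lambda>k. if t = 0 then (n - a, k) else if t = 1 then (a + k, a + 1) else (a + k, k)"
  have "{v \<in> pverts (triangular_graph n). tri_coord n t v = a} = ?g ` {1..n - a}" (is "?X = _")
  proof
    show "?g ` {1..n - a} \<subseteq> ?X" using assms by (auto simp: pverts_triangular_graph)
    show "?X \<subseteq> ?g ` {1..n - a}"
    proof
      fix v assume v: "v \<in> ?X"
      obtain i j where [simp]: "v = (i, j)" by (cases v)
      have "v = ?g (if t = 0 then j else if t = 1 then i - a else j)"
        using v assms by (auto simp: pverts_triangular_graph split: if_splits)
      moreover have "(if t = 0 then j else if t = 1 then i - a else j) \<in> {1..n - a}"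
        using v assms by (auto simp: pverts_triangular_graph split: if_splits)
      ultimately show "v \<in> ?g ` {1..n - a}" by blast
    qed
  qed
  moreover have "inj_on ?g {1..n - a}" by (auto simp: inj_on_def)
  ultimately have "card {v \<in> pverts (triangular_graph n). tri_coord n t v = a} = card {1..n - a}"
    by (simp only: card_image)
  then show ?thesis by simp
qed

text \<open>
  Two lines of different directions prescribe two coordinates \<open>a\<close> and \<open>b\<close>. The third one must be
  \<open>n - 1 - a - b\<close>, which is a coordinate of a vertex iff it is nonnegative.
\<close>

lemma card_two_lines:
  assumes st: "s < 3" "t < 3" "s \<noteq> t" and ab: "a < n" "b < n"
  shows "card {v \<in> pverts (triangular_graph n). tri_coord n s v = a \<and> tri_coord n t v = b}
    = of_bool (a + b < n)"
proof -
  define i where "i = (if s = 0 then n - a else if t = 0 then n - b else a + b + 1)"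
  define j where "j = (if s = 1 then a + 1 else if t = 1 then b + 1 else n - a - b)"
  have point: "(k, l) \<in> pverts (triangular_graph n) \<and> tri_coord n s (k, l) = a \<and> tri_coord n t (k, l) = b
      \<longleftrightarrow> a + b < n \<and> k = i \<and> l = j" for k l
  proof -
    have mem: "(k, l) \<in> pverts (triangular_graph n) \<longleftrightarrow> 1 \<le> l \<and> l \<le> k \<and> k \<le> n"
      by (auto simp: pverts_triangular_graph)
    consider "s = 0" "t = 1" | "s = 0" "t = 2" | "s = 1" "t = 0" | "s = 1" "t = 2"
      | "s = 2" "t = 0" | "s = 2" "t = 1" using st by linarith
    then show ?thesis
      unfolding mem using ab by cases (simp_all add: i_def j_def, linarith+)
  qed
  have "{v \<in> pverts (triangular_graph n). tri_coord n s v = a \<and> tri_coord n t v = b}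
      = (if a + b < n then {(i, j)} else {})"
    using point by (auto simp del: tri_coord.simps split: if_splits)
  then show ?thesis by simp
qed

lemma incidence_cogram:
  assumes vs: "set vs = pverts (triangular_graph n)" "distinct vs"
  shows "incidence_mat n vs * transpose_mat (incidence_mat n vs)
    = block_mat n (\<lambda>a b. if a = b then real (n - a) else 0) (\<lambda>a b. of_bool (a + b < n))" (is "?L = ?R")
proof (rule eq_matI)
  fix p q assume "p < dim_row ?R" "q < dim_col ?R"
  then have pq: "p < 3 * n" "q < 3 * n" by (auto simp: block_mat_def)
  then have div: "p div n < 3" "q div n < 3" by (simp_all add: less_mult_imp_div_less)
  have mod: "p mod n < n" "q mod n < n" using pq by auto
  let ?X = "{v \<in> pverts (triangular_graph n).
    tri_coord n (p div n) v = p mod n \<and> tri_coord n (q div n) v = q mod n}"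
  have fin: "finite (pverts (triangular_graph n))" unfolding vs(1)[symmetric] by simp
  have "?L $$ (p, q) = (\<Sum>k<length vs. of_bool (vs ! k \<in> ?X))"
  proof -
    have "vs ! k \<in> pverts (triangular_graph n)" if "k < length vs" for k
      using that vs(1) nth_mem by auto
    then have "(\<Sum>k<length vs. of_bool (vs ! k \<in> ?X))
        = (\<Sum>k<length vs. of_bool (tri_coord n (p div n) (vs ! k) = p mod n)
            * of_bool (tri_coord n (q div n) (vs ! k) = q mod n) :: real)"
      by (intro sum.cong refl) auto
    then show ?thesis
      using pq by (simp add: incidence_mat_def scalar_prod_def atLeast0LessThan)
  qed
  also have "\<dots> = (\<Sum>v\<in>set vs. of_bool (v \<in> ?X))"
    using bij_betw_nth[OF vs(2) refl refl] by (rule sum.reindex_bij_betw)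
  also have "\<dots> = real (card ?X)"
    using fin by (simp add: vs(1) of_bool_def Int_def flip: sum.inter_filter)
  also have "\<dots> = ?R $$ (p, q)"
  proof (cases "p div n = q div n")
    case True
    show ?thesis
    proof (cases "p mod n = q mod n")
      case eq: True
      have "?X = {v \<in> pverts (triangular_graph n). tri_coord n (p div n) v = p mod n}"
        using True eq by auto
      then show ?thesis
        using True eq pq card_line[OF div(1) mod(1)] by (simp add: block_mat_def)
    next
      case False
      then have "?X = {}" using True by auto
      then have "card ?X = 0" by (simp only: card.empty)
      then show ?thesis using True False pq by (simp add: block_mat_def)
    qed
  next
    case False
    then show ?thesis
      using pq card_two_lines[OF div False mod] by (simp add: block_mat_def)
  qed
  finally show "?L $$ (p, q) = ?R $$ (p, q)" .
qed (auto simp: incidence_mat_def block_mat_def)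

section \<open>The spectrum\<close>

text \<open>
  The numbers \<open>r\<close> and \<open>r + 1\<close> form the middle of \<open>1, ..., n\<close>. The Laplacian on the lines, which
  counts twice, misses only one of them and has the other, \<open>h\<close>, as an eigenvalue; the quotient
  matrix misses both. This is the source of the single multiplicity 2 among the multiplicities 3.
\<close>

lemma graph_spectrum_triangular_graph:
  assumes n: "n \<ge> 3"
  defines "r \<equiv> n div 2"
  defines "h \<equiv> if odd n then r else r + 1"
  shows "graph_spectrum (triangular_graph n) =
    image_mset (\<lambda>e. e - 3) ({#2 * real n + 1#}
      + repeat_mset 3 (image_mset real (mset_set ({1..n} - {r, r + 1})))
      + replicate_mset 2 (real h) + replicate_mset (triangular_number (n - 3)) 0)"
proof -
  have fin: "finite (pverts (triangular_graph n))" by (simp add: pverts_triangular_graph)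
  obtain vs where vs: "set vs = pverts (triangular_graph n)" "distinct vs"
    using finite_distinct_list[OF fin] by blast
  let ?N = "incidence_mat n vs" and ?A = "adjacency_matrix (triangular_graph n) vs"
  let ?X = "[:0, 1:] :: real poly" and ?R = "{1..n} - {r, r + 1}"
  let ?l = "\<lambda>e. [:- e, 1:] :: real poly"
  define P where "P = (\<Prod>e\<in>?R. ?l (real e))"
  define E where "E = {#2 * real n + 1#}
      + repeat_mset 3 (image_mset real (mset_set ?R))
      + replicate_mset 2 (real h) + replicate_mset (triangular_number (n - 3)) 0"
  define m where "m = length vs"
  have N: "?N \<in> carrier_mat (3 * n) m" by (simp add: incidence_mat_def m_def)
  have m: "m = triangular_number n"
    using vs card_pverts_triangular_graph[of n] distinct_card by (metis m_def)
  \<comment> \<open>The zero eigenvalue of the line matrix has multiplicity 3, so \<open>T(n) + 3\<close> factors \<open>x\<close> stand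
     against the \<open>3 n\<close> factors that are cancelled below.\<close>
  have tri: "triangular_number n + 3 = triangular_number (n - 3) + 3 * n"
  proof -
    obtain k where "n = k + 3" using n by (metis le_add_diff_inverse2)
    moreover have "(k + 3) * (k + 3 + 1) = k * (k + 1) + 2 * (3 * k + 6)" by (simp add: algebra_simps)
    ultimately show ?thesis by (simp add: triangular_number_def)
  qed
  have prod_insert2: "(\<Prod>e\<in>insert a (insert b R). f e) = f a * (f b * (\<Prod>e\<in>R. f e))"
    if "finite R" "a \<noteq> b" "a \<notin> R" "b \<notin> R" for a b R and f :: "nat \<Rightarrow> real poly"
    using that by simp
  have "char_poly (line_mat n 2) = ?X * ?l (2 * real n + 1) * P"
  proof -
    have "char_poly (line_mat n 2) = (\<Prod>e\<in>insert 0 (insert (2 * n + 1) ?R). ?l (real e))"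
      unfolding r_def by (rule char_poly_line_mat_quotient) (use n in simp)
    also have "\<dots> = ?X * (?l (2 * real n + 1) * P)"
      unfolding P_def by (subst prod_insert2) (simp_all add: add.commute)
    finally show ?thesis by (simp only: mult.assoc)
  qed
  moreover have "char_poly (line_mat n (-1)) = ?X * ?l (real h) * P"
  proof -
    have "{0..n} - {(n + 1) div 2} = insert 0 (insert h ?R)"
      unfolding h_def r_def using n by (auto elim!: oddE evenE)
    then have "char_poly (line_mat n (-1)) = (\<Prod>e\<in>insert 0 (insert h ?R). ?l (real e))"
      using char_poly_line_mat_laplacian[of n] n by simp
    also have "\<dots> = ?X * (?l (real h) * P)"
    proof -
      have "h \<noteq> 0" "h \<notin> ?R" using n by (auto simp: h_def r_def)
      then show ?thesis unfolding P_def by (subst prod_insert2) simp_all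
    qed
    finally show ?thesis by (simp only: mult.assoc)
  qed
  moreover have "char_poly (?N * transpose_mat ?N) = char_poly (line_mat n 2) * char_poly (line_mat n (-1)) ^ 2"
    unfolding incidence_cogram[OF vs] char_poly_block_mat line_mat_def
    by (intro arg_cong2[where f = "\<lambda>M M'. char_poly M * char_poly M' ^ 2"] eq_matI) auto
  ultimately have cogram: "char_poly (?N * transpose_mat ?N)
      = ?X ^ 3 * (?l (2 * real n + 1) * ?l (real h) ^ 2 * P ^ 3)"
    by (simp only: power2_eq_square power3_eq_cube mult_ac)
  have "?X ^ (3 * n) * char_poly (transpose_mat ?N * ?N) = ?X ^ m * char_poly (?N * transpose_mat ?N)"
    using N by (intro char_poly_mult_commute) auto
  also have "\<dots> = ?X ^ (triangular_number n + 3) * (?l (2 * real n + 1) * ?l (real h) ^ 2 * P ^ 3)"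
    unfolding cogram m by (simp only: power_add mult_ac)
  also have "\<dots> = ?X ^ (3 * n) * (?X ^ triangular_number (n - 3) * (?l (2 * real n + 1) * ?l (real h) ^ 2 * P ^ 3))"
    unfolding tri by (simp only: power_add mult_ac)
  finally have "char_poly (transpose_mat ?N * ?N)
      = ?X ^ triangular_number (n - 3) * (?l (2 * real n + 1) * ?l (real h) ^ 2 * P ^ 3)"
    by (subst (asm) mult_left_cancel) auto
  also have "\<dots> = (\<Prod>e\<in>#E. ?l e)"
  proof -
    have "(\<Prod>e\<in>#repeat_mset 3 (image_mset real (mset_set ?R)). ?l e) = P ^ 3"
      by (simp add: P_def numeral_3_eq_3 prod_unfold_prod_mset image_mset.compositionality comp_def)
    moreover have "(\<Prod>e\<in>#replicate_mset k a. ?l e) = ?l a ^ k" for k a by simp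
    ultimately show ?thesis
      unfolding E_def image_mset_union prod_mset.union by (simp add: mult_ac del: mult_pCons_left mult_pCons_right)
  qed
  finally have gram: "char_poly (transpose_mat ?N * ?N) = (\<Prod>e\<in>#E. ?l e)" .
  have "?A = transpose_mat ?N * ?N + (- 3) \<cdot>\<^sub>m 1\<^sub>m m"
    unfolding incidence_gram[OF vs] m_def by (rule eq_matI) (auto simp: adjacency_matrix_def)
  then have "char_poly ?A = (\<Prod>e\<in>#E. ?l (e + - 3))"
    using N by (simp only:) (intro char_poly_add_scalar gram, auto)
  also have "\<dots> = (\<Prod>e\<in>#image_mset (\<lambda>e. e - 3) E. ?l e)"
    by (simp add: image_mset.compositionality comp_def)
  finally have "char_poly ?A = (\<Prod>e\<in>#image_mset (\<lambda>e. e - 3) E. ?l e)" .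
  then show ?thesis
    by (simp only: graph_spectrum_eq[OF vs(2,1)] proots_prod_linear E_def)
qed

text \<open>
  Removing the middle pair from \<open>1, ..., n\<close> and subtracting 3 leaves the two runs. The case
  \<open>n = 3\<close>, where the lower run is empty, is included.
\<close>

lemma graph_spectrum_triangular_graph_runs:
  assumes n: "n \<ge> 3"
  defines "r \<equiv> int (n div 2)"
  shows "graph_spectrum (triangular_graph n) = {#2 * real n - 2#}
    + (\<Sum>k = r - 1..int n - 3. replicate_mset 3 (real_of_int k))
    + replicate_mset 2 (real_of_int (if odd n then r - 3 else r - 2))
    + (\<Sum>k = - 2..r - 4. replicate_mset 3 (real_of_int k))
    + replicate_mset (triangular_number (n - 3)) (- 3)"
proof -
  let ?R = "{1..n} - {n div 2, n div 2 + 1}"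
  have run: "image_mset (\<lambda>e. e - 3) (repeat_mset 3 (image_mset real (mset_set S)))
      = (\<Sum>i\<in>S. replicate_mset 3 (real i - 3))" if "finite S" for S
    using that by (induction S) (auto simp: numeral_3_eq_3)
  have "image_mset (\<lambda>e. e - 3) (repeat_mset 3 (image_mset real (mset_set ?R)))
      = (\<Sum>i\<in>?R. replicate_mset 3 (real i - 3))" by (rule run) simp
  also have "(\<Sum>i\<in>?R. replicate_mset 3 (real i - 3))
      = (\<Sum>k\<in>(\<lambda>i. int i - 3) ` ?R. replicate_mset 3 (real_of_int k))"
    by (subst sum.reindex) (auto simp: inj_on_def)
  also have "(\<lambda>i. int i - 3) ` ?R = {r - 1..int n - 3} \<union> {- 2..r - 4}" (is "_ = ?K")
  proof
    show "?K \<subseteq> (\<lambda>i. int i - 3) ` ?R"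
    proof
      fix k assume "k \<in> ?K"
      then have "k = int (nat (k + 3)) - 3" "nat (k + 3) \<in> ?R" using n by (auto simp: r_def)
      then show "k \<in> (\<lambda>i. int i - 3) ` ?R" by (rule image_eqI)
    qed
  qed (use n in \<open>auto simp: r_def\<close>)
  also have "(\<Sum>k\<in>?K. replicate_mset 3 (real_of_int k))
      = (\<Sum>k = r - 1..int n - 3. replicate_mset 3 (real_of_int k))
        + (\<Sum>k = - 2..r - 4. replicate_mset 3 (real_of_int k))"
    by (rule sum.union_disjoint) auto
  finally have "image_mset (\<lambda>e. e - 3) (repeat_mset 3 (image_mset real (mset_set ?R))) = \<dots>" .
  then show ?thesis
    unfolding graph_spectrum_triangular_graph[OF n] image_mset_union
    by (auto simp: r_def add_ac)
qed

section \<open>Complete graphs\<close>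

lemma graph_isomorphic_complete_graph:
  assumes G: "pair_graph G"
    and complete: "\<And>u v. u \<in> pverts G \<Longrightarrow> v \<in> pverts G \<Longrightarrow> u \<noteq> v \<Longrightarrow> (u, v) \<in> parcs G"
  shows "graph_isomorphic G (complete_graph (card (pverts G)))"
proof -
  interpret pair_graph G by (rule G)
  obtain f where f: "bij_betw f (pverts G) {..<card (pverts G)}"
    using ex_bij_betw_finite_nat[OF finite_verts] by (auto simp: atLeast0LessThan)
  then have inj: "inj_on f (pverts G)" and img: "f ` pverts G = {..<card (pverts G)}"
    by (auto simp: bij_betw_def)
  have arcs: "parcs G = {(u, v). u \<in> pverts G \<and> v \<in> pverts G \<and> u \<noteq> v}"
    using complete by (auto dest: in_arcsD1 in_arcsD2 no_loops')
  define F where "F = \<lparr>iso_verts = f, iso_arcs = map_prod f f, iso_head = snd, iso_tail = fst\<rparr>"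
  have "digraph_isomorphism F"
    unfolding digraph_isomorphism_def F_def
    using inj wf_digraph_axioms by (auto simp: arcs inj_on_def)
  moreover have "with_proj (complete_graph (card (pverts G))) = app_iso F (with_proj G)"
  proof -
    have less: "u < card (pverts G) \<longleftrightarrow> u \<in> f ` pverts G" for u
      unfolding img by simp
    have "map_prod f f ` parcs G = {(u, v). u < card (pverts G) \<and> v < card (pverts G) \<and> u \<noteq> v}"
    proof (intro equalityI subsetI)
      fix e assume "e \<in> map_prod f f ` parcs G"
      then show "e \<in> {(u, v). u < card (pverts G) \<and> v < card (pverts G) \<and> u \<noteq> v}"
        unfolding less arcs by (auto dest: inj_onD[OF inj])
    next
      fix e assume "e \<in> {(u, v). u < card (pverts G) \<and> v < card (pverts G) \<and> u \<noteq> v}"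
      then obtain x y where "e = map_prod f f (x, y)" "(x, y) \<in> parcs G"
        unfolding less arcs by auto
      then show "e \<in> map_prod f f ` parcs G" by (rule image_eqI)
    qed
    then show ?thesis by (simp add: F_def app_iso_def with_proj_def complete_graph_def img)
  qed
  ultimately show ?thesis unfolding graph_isomorphic_def digraph_iso_def by blast
qed

section \<open>The spectra of all triangular graphs\<close>

theorem theorem3p19:
  shows "(\<forall>n\<in>{1, 2}. graph_isomorphic (triangular_graph n) (complete_graph (triangular_number n))) \<and>
    graph_spectrum (triangular_graph 3) = {#4#} + replicate_mset 3 0 + replicate_mset 2 (- 2) \<and>
    (\<forall>n\<ge>4.
      (odd n \<longrightarrow> graph_spectrum (triangular_graph n) =
        {#2 * real n - 2#}
        + (\<Sum>k = (int n - 3) div 2..int n - 3. replicate_mset 3 (real_of_int k))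
        + replicate_mset 2 ((real n - 7) / 2)
        + (\<Sum>k = - 2..(int n - 9) div 2. replicate_mset 3 (real_of_int k))
        + replicate_mset (triangular_number (n - 3)) (- 3)) \<and>
      (even n \<longrightarrow> graph_spectrum (triangular_graph n) =
        {#2 * real n - 2#}
        + (\<Sum>k = (int n - 2) div 2..int n - 3. replicate_mset 3 (real_of_int k))
        + replicate_mset 2 ((real n - 4) / 2)
        + (\<Sum>k = - 2..(int n - 8) div 2. replicate_mset 3 (real_of_int k))
        + replicate_mset (triangular_number (n - 3)) (- 3)))"
proof (intro conjI ballI allI impI)
  fix n :: nat assume "n \<in> {1, 2}"
  then have "graph_isomorphic (triangular_graph n) (complete_graph (card (pverts (triangular_graph n))))"
    by (intro graph_isomorphic_complete_graph pair_graph_triangular_graph)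
      (auto simp: triangular_graph_def Let_def le_Suc_eq numeral_2_eq_2)
  then show "graph_isomorphic (triangular_graph n) (complete_graph (triangular_number n))"
    by (simp add: card_pverts_triangular_graph)
next
  show "graph_spectrum (triangular_graph 3) = {#4#} + replicate_mset 3 0 + replicate_mset 2 (- 2)"
    by (subst graph_spectrum_triangular_graph_runs) (simp_all add: triangular_number_def)
next
  fix n :: nat assume n: "n \<ge> 4" "odd n"
  then obtain r where r: "n = 2 * r + 1" by (elim oddE)
  then have eqs: "n div 2 = r" "(int n - 3) div 2 = int r - 1" "(int n - 9) div 2 = int r - 4"
      "(real n - 7) / 2 = real_of_int (int r - 3)" by auto
  then show "graph_spectrum (triangular_graph n) =
        {#2 * real n - 2#}
        + (\<Sum>k = (int n - 3) div 2..int n - 3. replicate_mset 3 (real_of_int k))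
        + replicate_mset 2 ((real n - 7) / 2)
        + (\<Sum>k = - 2..(int n - 9) div 2. replicate_mset 3 (real_of_int k))
        + replicate_mset (triangular_number (n - 3)) (- 3)"
    unfolding eqs(2-4) using graph_spectrum_triangular_graph_runs[of n] n eqs(1) by simp
next
  fix n :: nat assume n: "n \<ge> 4" "even n"
  then obtain r where r: "n = 2 * r" by (elim evenE)
  then have eqs: "n div 2 = r" "(int n - 2) div 2 = int r - 1" "(int n - 8) div 2 = int r - 4"
      "(real n - 4) / 2 = real_of_int (int r - 2)" by auto
  then show "graph_spectrum (triangular_graph n) =
        {#2 * real n - 2#}
        + (\<Sum>k = (int n - 2) div 2..int n - 3. replicate_mset 3 (real_of_int k))
        + replicate_mset 2 ((real n - 4) / 2)
        + (\<Sum>k = - 2..(int n - 8) div 2. replicate_mset 3 (real_of_int k))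
        + replicate_mset (triangular_number (n - 3)) (- 3)"
    unfolding eqs(2-4) using graph_spectrum_triangular_graph_runs[of n] n eqs(1) by simp
qed

end
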